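(* Let $M$ be a $2$-regular $0,1$ matrix of dimensions $n \times n$. Then $M$ is equal, up to permutations of rows and columns, to a $(2;n_1, \ldots,n_m)$ circulant block diagonal matrix for some integers $m \geq 1$ and $n_1,\ldots,n_m \geq 2$. Let $m_2$ denote the number of indices $i \in [m]$ with $n_i=2$, and let $m_{even}$ denote the number of indices $i \in [m]$ for which $n_i$ is even. Unless $M$ is the all-one $2 \times 2$ matrix, it holds that \[\mathrm{rank}_{\mathrm{bin}}(M) = n-m_2\quad\text{and}\quad\mathrm{rank}_{\mathrm{bin}}(\overline{M}) \in \{n-m_{even}, n-m_{even}+1\}.\]
   Context: A square $0,1$ matrix is $k$-regular if every row and every column has precisely $k$ ones. For integers $n \ge k \ge 0$, $D_{n,k}$ denotes the $n\times n$ circulant $0,1$ matrix whose first row consists of $n-k$ ones followed by $k$ zeros, each subsequent row being the cyclic shift of the previous row by one position to the right. For integers $n_i\ge 2$, a $(2;n_1,\ldots,n_m)$ circulant block diagonal matrix is a block matrix with $m$ diagonal blocks whose $i$th diagonal block is $D_{n_i,n_i-2}$ (first row: two ones followed by $n_i-2$ zeros) and all of whose other entries are zero. $\overline{M}$ is the complement of $M$ (zeros and ones swapped). The binary rank $\mathrm{rank}_{\mathrm{bin}}(A)$ of a $0,1$ matrix $A$ is the smallest number of combinatorial rectangles (all-one submatrices indexed by a set of rows times a set of columns) that partition the ones of $A$ (equivalently, the smallest inner dimension of a factorization $A=A_1A_2$ over the reals with $0,1$ factors). *)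

theory Defs
  imports "Jordan_Normal_Form.Matrix" "HOL-Combinatorics.Permutations"
    "HOL-Library.Disjoint_Sets"
begin

definition zero_one_mat :: "real mat \<Rightarrow> bool" where
  "zero_one_mat A \<longleftrightarrow>
     (\<forall>i < dim_row A. \<forall>j < dim_col A. A $$ (i, j) = 0 \<or> A $$ (i, j) = 1)"

definition regular_mat :: "nat \<Rightarrow> real mat \<Rightarrow> bool" where
  "regular_mat k A \<longleftrightarrow> square_mat A \<and> zero_one_mat A \<and>
     (\<forall>i < dim_row A. card {j. j < dim_col A \<and> A $$ (i, j) = 1} = k) \<and>
     (\<forall>j < dim_col A. card {i. i < dim_row A \<and> A $$ (i, j) = 1} = k)"

text \<open>Row \<open>i\<close> is the first row shifted cyclically by \<open>i\<close> positions to the right, so its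
  entry in column \<open>j\<close> is the entry of the first row in column \<open>j - i\<close> modulo \<open>n\<close>;
  the summand \<open>n\<close> avoids truncated subtraction. Meant for \<open>k \<le> n\<close>.\<close>

definition circ_mat :: "nat \<Rightarrow> nat \<Rightarrow> real mat" where
  "circ_mat n k = mat n n (\<lambda>(i, j). if (n + j - i) mod n < n - k then 1 else 0)"

text \<open>The diagonal blocks for the list \<open>[n\<^sub>1, \<dots>, n\<^sub>m]\<close> of sizes; meant for sizes at least 2.\<close>

definition circ_block_diag2 :: "nat list \<Rightarrow> real mat" where
  "circ_block_diag2 ns = diag_block_mat (map (\<lambda>k. circ_mat k (k - 2)) ns)"

definition perm_equiv_mat :: "real mat \<Rightarrow> real mat \<Rightarrow> bool" where
  "perm_equiv_mat A B \<longleftrightarrow> dim_row A = dim_row B \<and> dim_col A = dim_col B \<and>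
     (\<exists>p q. p permutes {..<dim_row B} \<and> q permutes {..<dim_col B} \<and>
        A = mat (dim_row B) (dim_col B) (\<lambda>(i, j). B $$ (p i, q j)))"

definition compl_mat :: "real mat \<Rightarrow> real mat" where
  "compl_mat A = map_mat (\<lambda>x. 1 - x) A"

definition ones_of :: "real mat \<Rightarrow> (nat \<times> nat) set" where
  "ones_of A = {(i, j). i < dim_row A \<and> j < dim_col A \<and> A $$ (i, j) = 1}"

text \<open>A partition consists of nonempty, pairwise disjoint sets of positions with union
  \<^term>\<open>ones_of A\<close>, so every rectangle in it is an all-one submatrix. The partition into
  singletons shows that the minimum exists, and partitions of the finite set
  \<^term>\<open>ones_of A\<close> are finite, so \<^const>\<open>card\<close> is meaningful.\<close>

definition binary_rank :: "real mat \<Rightarrow> nat" where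
  "binary_rank A = (LEAST r. \<exists>P. partition_on (ones_of A) P \<and>
     (\<forall>R \<in> P. \<exists>I J. R = I \<times> J) \<and> card P = r)"

end

theory Submission
  imports Defs "HOL-Combinatorics.Cycles"
begin

text \<open>Rows and columns of a 2-regular matrix are the two sides of a bipartite graph whose components
  are cycles, which gives the block form. Writing the columns of a block as a cycle, each row \<open>v\<close>
  has its ones in the columns \<open>v\<close> and \<open>succ v\<close>, so the row space of the complement is that of the
  matrix (unless \<open>n = 2\<close>), of codimension \<open>m_even\<close>.

  For the upper bound on the complement let \<open>p v = {v, succ v}\<close>. In an even cycle the sets \<open>p v\<close> with
  \<open>v\<close> at even positions partition the cycle, and so do those at odd positions. Take as column sets
  the singletons of the odd cycles, and in each even cycle all the \<open>p v\<close> except that of the last (odd)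
  position; the excluded sets of all the even cycles are united into a single extra column set.
  The complement of every \<open>p v\<close> is a disjoint union of such sets.\<close>

section \<open>Rectangle partitions of relations\<close>

text \<open>Stated for relations between arbitrary types, so that rows and columns can be labelled
  by pairs (block, position) instead of matrix indices.\<close>

definition rect_partition :: "('a \<times> 'b) set \<Rightarrow> ('a \<times> 'b) set set \<Rightarrow> bool" where
  "rect_partition E P \<longleftrightarrow> partition_on E P \<and> (\<forall>R \<in> P. \<exists>I J. R = I \<times> J)"

definition rect_rank :: "('a \<times> 'b) set \<Rightarrow> nat" where
  "rect_rank E = (LEAST r. \<exists>P. rect_partition E P \<and> card P = r)"

lemma binary_rank_eq_rect_rank: "binary_rank A = rect_rank (ones_of A)"
  by (simp add: binary_rank_def rect_rank_def rect_partition_def conj_assoc)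

lemma rect_rank_le: "rect_partition E P \<Longrightarrow> rect_rank E \<le> card P"
  unfolding rect_rank_def by (rule Least_le) blast

lemma rect_rank_attained: "\<exists>P. rect_partition E P \<and> card P = rect_rank E"
proof -
  have "rect_partition E ((\<lambda>x. {x}) ` E)"
    unfolding rect_partition_def
  proof (intro conjI partition_on_singletons ballI)
    fix R assume "R \<in> (\<lambda>x. {x}) ` E"
    then obtain a b where "R = {(a, b)}" by auto
    then have "R = {a} \<times> {b}" by simp
    then show "\<exists>I J. R = I \<times> J" by blast
  qed
  then have "\<exists>r P. rect_partition E P \<and> card P = r" by blast
  from LeastI_ex[OF this] show ?thesis unfolding rect_rank_def .
qed

text \<open>The form in which upper bounds are proved: every pair of \<open>E\<close> lies in
  exactly one product. Empty products are allowed in the family; discarding them only lowers the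
  count.\<close>

lemma rect_rank_le_family:
  assumes "finite T"
    and sub: "\<And>t. t \<in> T \<Longrightarrow> I t \<times> J t \<subseteq> E"
    and ex: "\<And>v w. (v, w) \<in> E \<Longrightarrow> \<exists>t\<in>T. v \<in> I t \<and> w \<in> J t"
    and uniq: "\<And>v w s t. \<lbrakk>(v, w) \<in> E; s \<in> T; t \<in> T; v \<in> I s; w \<in> J s; v \<in> I t; w \<in> J t\<rbrakk> \<Longrightarrow> s = t"
  shows "rect_rank E \<le> card T"
proof -
  let ?P = "(\<lambda>t. I t \<times> J t) ` T - {{}}"
  have "partition_on E ?P"
  proof (rule partition_onI)
    have "\<Union>?P = (\<Union>t\<in>T. I t \<times> J t)" by blast
    also have "\<dots> = E"
    proof
      show "E \<subseteq> (\<Union>t\<in>T. I t \<times> J t)"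
      proof
        fix e assume "e \<in> E"
        then show "e \<in> (\<Union>t\<in>T. I t \<times> J t)" using ex[of "fst e" "snd e"] by (auto simp: mem_Times_iff)
      qed
    qed (rule UN_least, rule sub)
    finally show "\<Union>?P = E" .
    fix p q assume pq: "p \<in> ?P" "q \<in> ?P" "p \<noteq> q"
    then obtain s t where st: "s \<in> T" "t \<in> T" "p = I s \<times> J s" "q = I t \<times> J t" by blast
    show "disjnt p q"
    proof (rule ccontr)
      assume "\<not> disjnt p q"
      then obtain v w where "(v, w) \<in> p" "(v, w) \<in> q" by (auto simp: disjnt_def)
      then have "s = t" using uniq[of v w s t] sub[of s] st by auto
      then show False using st pq by simp
    qed
  qed simp
  then have "rect_partition E ?P" unfolding rect_partition_def by blast
  then have "rect_rank E \<le> card ?P" by (rule rect_rank_le)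
  also have "\<dots> \<le> card ((\<lambda>t. I t \<times> J t) ` T)"
    using assms(1) by (intro card_mono) auto
  also have "\<dots> \<le> card T" using assms(1) by (rule card_image_le)
  finally show ?thesis .
qed

lemma rect_rank_image_le:
  assumes "inj_on f A" "inj_on g B" "E \<subseteq> A \<times> B" "finite E"
  shows "rect_rank (map_prod f g ` E) \<le> rect_rank E"
proof -
  obtain P where P: "rect_partition E P" "card P = rect_rank E"
    using rect_rank_attained by blast
  let ?Q = "(`) (map_prod f g) ` P - {{}}"
  have "inj_on (map_prod f g) E"
    using map_prod_inj_on[OF assms(1,2)] assms(3) inj_on_subset by blast
  then have "partition_on (map_prod f g ` E) ?Q"
    using P(1) partition_on_inj_image unfolding rect_partition_def by blast
  moreover have "\<exists>I J. R = I \<times> J" if "R \<in> ?Q" for R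
  proof -
    obtain S where S: "S \<in> P" "R = map_prod f g ` S" using \<open>R \<in> ?Q\<close> by blast
    then obtain I J where "S = I \<times> J" using P(1) unfolding rect_partition_def by blast
    then have "R = f ` I \<times> g ` J" using S(2) by (simp add: map_prod_surj_on)
    then show ?thesis by blast
  qed
  ultimately have "rect_rank (map_prod f g ` E) \<le> card ?Q"
    by (intro rect_rank_le) (simp add: rect_partition_def)
  also have "\<dots> \<le> card P"
  proof -
    have "finite P" using P(1) assms(4) finite_elements unfolding rect_partition_def by blast
    then show ?thesis by (meson card_image_le card_mono finite_imageI le_trans Diff_subset)
  qed
  finally show ?thesis using P(2) by simp
qed

text \<open>Relabelling rows and columns injectively maps rectangles to rectangles, which gives one
  inequality; the other is the same fact for the inverse relabelling.\<close>

lemma rect_rank_image: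
  assumes "inj_on f A" "inj_on g B" "E \<subseteq> A \<times> B" "finite E"
  shows "rect_rank (map_prod f g ` E) = rect_rank E"
proof (rule antisym[OF rect_rank_image_le[OF assms]])
  let ?f = "inv_into A f" and ?g = "inv_into B g"
  have "map_prod ?f ?g ` map_prod f g ` E = (\<lambda>x. x) ` E"
    unfolding image_image using assms(1-3) by (intro image_cong) auto
  moreover have "rect_rank (map_prod ?f ?g ` map_prod f g ` E) \<le> rect_rank (map_prod f g ` E)"
    using assms by (intro rect_rank_image_le[of _ "f ` A" _ "g ` B"] inj_on_inv_into) auto
  ultimately show "rect_rank E \<le> rect_rank (map_prod f g ` E)" by simp
qed

section \<open>Disjoint unions of directed cycles\<close>

text \<open>A pair \<open>(i, a)\<close> stands for position \<open>a\<close> in block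
  \<open>i\<close>. The same pairs label both rows and columns, so \<open>cyc_adj\<close> below
  relates a row to a column and is not symmetric.\<close>

definition cyc_idx :: "nat list \<Rightarrow> (nat \<times> nat) set" where
  "cyc_idx ns = (SIGMA i:{..<length ns}. {..<ns ! i})"

definition cyc_succ :: "nat list \<Rightarrow> nat \<times> nat \<Rightarrow> nat \<times> nat" where
  "cyc_succ ns v = (fst v, Suc (snd v) mod ns ! fst v)"

definition cyc_adj :: "nat list \<Rightarrow> nat \<times> nat \<Rightarrow> nat \<times> nat \<Rightarrow> bool" where
  "cyc_adj ns v w \<longleftrightarrow> w = v \<or> w = cyc_succ ns v"

definition cyc_rel :: "nat list \<Rightarrow> ((nat \<times> nat) \<times> (nat \<times> nat)) set" where
  "cyc_rel ns = {(v, w) \<in> cyc_idx ns \<times> cyc_idx ns. cyc_adj ns v w}"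

definition cyc_corel :: "nat list \<Rightarrow> ((nat \<times> nat) \<times> (nat \<times> nat)) set" where
  "cyc_corel ns = {(v, w) \<in> cyc_idx ns \<times> cyc_idx ns. \<not> cyc_adj ns v w}"

lemma finite_cyc_idx [simp]: "finite (cyc_idx ns)"
  by (simp add: cyc_idx_def)

lemma finite_cyc_rel [simp]: "finite (cyc_rel ns)" "finite (cyc_corel ns)"
  by (auto simp: cyc_rel_def cyc_corel_def intro: finite_subset[of _ "cyc_idx ns \<times> cyc_idx ns"])

lemma card_cyc_idx: "card (cyc_idx ns) = sum_list ns"
  by (simp add: cyc_idx_def sum_list_sum_nth atLeast0LessThan)

lemma cyc_succ_in: "v \<in> cyc_idx ns \<Longrightarrow> cyc_succ ns v \<in> cyc_idx ns"
  by (auto simp: cyc_idx_def cyc_succ_def)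

lemma Suc_mod_if: "b < n \<Longrightarrow> Suc b mod n = (if Suc b = n then 0 else Suc b)"
  by auto

lemma cyc_succ_inj: "inj_on (cyc_succ ns) (cyc_idx ns)"
  by (auto simp: inj_on_def cyc_idx_def cyc_succ_def Suc_mod_if split: if_splits)

lemma cyc_succ_bij: "bij_betw (cyc_succ ns) (cyc_idx ns) (cyc_idx ns)"
  using cyc_succ_inj cyc_succ_in
  by (metis bij_betw_imageI endo_inj_surj finite_cyc_idx image_subsetI)

lemma cyc_succ_neq: "\<forall>k\<in>set ns. 2 \<le> k \<Longrightarrow> v \<in> cyc_idx ns \<Longrightarrow> cyc_succ ns v \<noteq> v"
  by (cases v) (auto simp: cyc_idx_def cyc_succ_def Suc_mod_if split: if_splits dest!: nth_mem)

text \<open>This is what rules out a 2 by 2 all-one submatrix in a block of size other than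
  2.\<close>

lemma cyc_succ_succ_neq:
  assumes "\<forall>k\<in>set ns. 2 \<le> k" "v \<in> cyc_idx ns" "ns ! fst v \<noteq> 2"
  shows "cyc_succ ns (cyc_succ ns v) \<noteq> v"
proof (cases v)
  case (Pair i a)
  then have "a < ns ! i" "ns ! i \<noteq> 2" "2 \<le> ns ! i" using assms by (auto simp: cyc_idx_def)
  then show ?thesis using Pair by (auto simp: cyc_succ_def mod_Suc)
qed

section \<open>Rank of a disjoint union of cycles\<close>

text \<open>A block of size 2 is all-one and forms a single rectangle, indexed by its position 0;
  hence position 1 is removed from the index set. Every other row is a rectangle of its own.\<close>

lemma rect_rank_cyc_rel_le:
  assumes "\<forall>k\<in>set ns. 2 \<le> k"
  shows "rect_rank (cyc_rel ns) \<le> sum_list ns - card {i. i < length ns \<and> ns ! i = 2}"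
proof -
  let ?N = "{i. i < length ns \<and> ns ! i = 2}"
  let ?T = "cyc_idx ns - ?N \<times> {1}"
  define I where "I v = (if ns ! fst v = 2 then {fst v} \<times> {0, 1} else {v})" for v :: "nat \<times> nat"
  define J where "J v = (if ns ! fst v = 2 then {fst v} \<times> {0, 1} else {v, cyc_succ ns v})"
    for v :: "nat \<times> nat"
  have "rect_rank (cyc_rel ns) \<le> card ?T"
  proof (rule rect_rank_le_family[where I = I and J = J])
    fix t assume t: "t \<in> ?T"
    then show "I t \<times> J t \<subseteq> cyc_rel ns"
      using cyc_succ_in[of t ns]
      by (auto simp: I_def J_def cyc_rel_def cyc_adj_def cyc_idx_def cyc_succ_def split: if_splits)
  next
    fix v w assume vw: "(v, w) \<in> cyc_rel ns"
    show "\<exists>t\<in>?T. v \<in> I t \<and> w \<in> J t"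
    proof (cases "ns ! fst v = 2")
      case True
      then show ?thesis using vw
        by (intro bexI[of _ "(fst v, 0)"])
          (auto simp: I_def J_def cyc_rel_def cyc_adj_def cyc_idx_def cyc_succ_def)
    next
      case False
      then show ?thesis using vw
        by (intro bexI[of _ v]) (auto simp: I_def J_def cyc_rel_def cyc_adj_def)
    qed
  next
    fix v w s t assume "s \<in> ?T" "t \<in> ?T" "v \<in> I s" "v \<in> I t"
    then show "s = t"
      by (cases s; cases t) (auto simp: I_def cyc_idx_def less_2_cases_iff split: if_splits)
  qed simp
  also have "card ?T = sum_list ns - card (?N \<times> {1::nat})"
    unfolding card_cyc_idx[symmetric] by (rule card_Diff_subset) (auto simp: cyc_idx_def)
  finally show ?thesis by (simp add: card_cartesian_product)
qed

lemma sum_cyc_idx: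
  "(\<Sum>v\<in>cyc_idx ns. g v) = (\<Sum>i<length ns. \<Sum>a<ns ! i. g (i, a))"
  unfolding cyc_idx_def by (simp add: sum.Sigma)

text \<open>Give each one of the matrix the weight \<open>1/2\<close>, and \<open>1/4\<close> inside a block of size 2.
  Then no rectangle has weight above 1, because the bipartite graph of a larger block contains
  no 4-cycle.\<close>

lemma rect_rank_cyc_rel_ge:
  assumes ge2: "\<forall>k\<in>set ns. 2 \<le> k"
  shows "sum_list ns - card {i. i < length ns \<and> ns ! i = 2} \<le> rect_rank (cyc_rel ns)"
proof -
  obtain P where P: "rect_partition (cyc_rel ns) P" "card P = rect_rank (cyc_rel ns)"
    using rect_rank_attained by blast
  then have part: "partition_on (cyc_rel ns) P" and rect: "\<And>R. R \<in> P \<Longrightarrow> \<exists>I J. R = I \<times> J"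
    by (auto simp: rect_partition_def)
  let ?two = "\<lambda>i. ns ! i = 2"
  define u where "u e = (if ?two (fst (fst e)) then 1/4 else 1/2 :: real)"
    for e :: "(nat \<times> nat) \<times> (nat \<times> nat)"
  have finR: "finite R" if "R \<in> P" for R
    using that part finite_cyc_rel(1) by (metis Union_upper finite_subset partition_onD1)
  have le1: "sum u R \<le> 1" if R: "R \<in> P" for R
  proof -
    obtain I J where IJ: "R = I \<times> J" using rect R by blast
    have sub: "I \<times> J \<subseteq> cyc_rel ns" using R IJ part by (auto simp: partition_on_def)
    have "R \<noteq> {}" using R part by (auto simp: partition_on_def)
    then obtain x y where xy: "x \<in> I" "y \<in> J" using IJ by auto
    have fin: "finite I" "finite J" using finR[OF R] IJ xy
      by (auto dest: finite_cartesian_productD1 finite_cartesian_productD2)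
    have adj: "w \<in> {v, cyc_succ ns v}" "v \<in> cyc_idx ns" "w \<in> cyc_idx ns" "fst v = fst w"
      if "v \<in> I" "w \<in> J" for v w
      using sub that by (auto simp: cyc_rel_def cyc_adj_def cyc_succ_def)
    have blk: "fst v = fst x" if "v \<in> I" for v using adj(4)[OF that xy(2)] adj(4)[OF xy] by simp
    have J2: "J \<subseteq> {x, cyc_succ ns x}" using adj(1)[OF xy(1)] by blast
    have cJ: "card J \<le> 2"
      using card_mono[OF _ J2] card_insert_le_m1[of 2 "{cyc_succ ns x}" x] by simp
    \<comment> \<open>Column \<open>y\<close> meets only row \<open>y\<close> and the row of its
      predecessor, which is expressed by \<open>inv_into\<close>.\<close>
    have I2: "card I \<le> 2"
    proof -
      have "I \<subseteq> {v \<in> cyc_idx ns. v = y \<or> cyc_succ ns v = y}" using adj[OF _ xy(2)] by blast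
      also have "\<dots> \<subseteq> {y, inv_into (cyc_idx ns) (cyc_succ ns) y}"
        using cyc_succ_inj[of ns] by (auto simp: inv_into_f_f)
      finally have "card I \<le> card {y, inv_into (cyc_idx ns) (cyc_succ ns) y}"
        by (intro card_mono) auto
      also have "\<dots> \<le> 2" using card_insert_le_m1[of 2 "{inv_into (cyc_idx ns) (cyc_succ ns) y}" y] by simp
      finally show ?thesis .
    qed
    have sumR: "sum u R = card I * card J * (if ?two (fst x) then 1/4 else 1/2)"
    proof -
      have "sum u R = (\<Sum>e\<in>R. if ?two (fst x) then 1/4 else 1/2)"
        using blk IJ by (intro sum.cong) (auto simp: u_def)
      then show ?thesis using IJ by (simp add: card_cartesian_product)
    qed
    show ?thesis
    proof (cases "?two (fst x)")
      case True
      have "card I * card J \<le> 2 * 2" using I2 cJ by (rule mult_le_mono)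
      then have "real (card I * card J) \<le> 4" by linarith
      then show ?thesis using sumR True by simp
    next
      case False
      have "card I \<le> 1 \<or> card J \<le> 1"
      proof (rule ccontr)
        assume "\<not> (card I \<le> 1 \<or> card J \<le> 1)"
        then have c: "card I > 1" "card J > 1" by auto
        \<comment> \<open>With two columns in \<open>J\<close>, every row in \<open>I\<close> has
          exactly \<open>J\<close> as its set of ones. Two distinct rows with the same pair of ones
          are then successors of each other, which forces block size 2.\<close>
        have JJ: "J = {v, cyc_succ ns v}" if "v \<in> I" for v
        proof (rule card_seteq)
          show "J \<subseteq> {v, cyc_succ ns v}" using adj(1)[OF that] by blast
          show "card {v, cyc_succ ns v} \<le> card J"
            using c card_insert_le_m1[of 2 "{cyc_succ ns v}" v] by simp
        qed simp
        obtain x' where x': "x' \<in> I" "x' \<noteq> x"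
          using c(1) fin by (metis One_nat_def card_le_Suc0_iff_eq not_less)
        have "{x, cyc_succ ns x} = {x', cyc_succ ns x'}" using JJ[OF xy(1)] JJ[OF x'(1)] by simp
        then have "cyc_succ ns (cyc_succ ns x) = x" using x'(2) by (auto simp: doubleton_eq_iff)
        then show False using cyc_succ_succ_neq[OF ge2 _ False] adj(2)[OF xy] by blast
      qed
      then have "card I * card J \<le> 2"
        using I2 cJ mult_le_mono[of "card I" 1 "card J" 2] mult_le_mono[of "card I" 2 "card J" 1]
        by auto
      then have "real (card I * card J) \<le> 2" by linarith
      then show ?thesis using sumR False by simp
    qed
  qed
  \<comment> \<open>Summing by rows: a row has weight 1, or 1/2 in a block of size 2. The two rows
    of such a block thus contribute 1, that is, its size minus 1.\<close>
  have "sum u (cyc_rel ns) = (\<Sum>v\<in>cyc_idx ns. \<Sum>w\<in>{v, cyc_succ ns v}. u (v, w))"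
  proof -
    have "cyc_rel ns = (SIGMA v:cyc_idx ns. {v, cyc_succ ns v})"
      using cyc_succ_in by (auto simp: cyc_rel_def cyc_adj_def)
    then show ?thesis by (simp add: sum.Sigma)
  qed
  also have "\<dots> = (\<Sum>v\<in>cyc_idx ns. if ?two (fst v) then 1/2 else 1)"
  proof (rule sum.cong[OF refl])
    fix v assume "v \<in> cyc_idx ns"
    then have "v \<noteq> cyc_succ ns v" using cyc_succ_neq[OF ge2] by metis
    then show "(\<Sum>w\<in>{v, cyc_succ ns v}. u (v, w)) = (if ?two (fst v) then 1/2 else 1)"
      by (simp add: u_def)
  qed
  also have "\<dots> = (\<Sum>i<length ns. real (ns ! i) - (if ?two i then 1 else 0))"
    unfolding sum_cyc_idx by (intro sum.cong) auto
  also have "\<dots> = real (sum_list ns) - real (card {i. i < length ns \<and> ?two i})"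
  proof -
    have "(\<Sum>i<length ns. if ?two i then 1 else 0 :: real) = real (card {i. i < length ns \<and> ?two i})"
      by (simp add: sum.If_cases Int_def)
    then show ?thesis by (simp add: sum_subtractf sum_list_sum_nth atLeast0LessThan)
  qed
  finally have tot: "sum u (cyc_rel ns) = \<dots>" .
  have "sum u (cyc_rel ns) = sum (sum u) P"
    using part finR unfolding partition_on_def
    by (metis (no_types, lifting) sum.Union_disjoint_sets comp_apply)
  also have "\<dots> \<le> real (card P)" using sum_mono[of P "sum u" "\<lambda>_. 1"] le1 by simp
  finally show ?thesis using tot P(2) by linarith
qed

section \<open>Rank of the complement of a disjoint union of cycles\<close>

text \<open>Gaussian elimination: equation \<open>t\<close> is used to eliminate one unknown
  \<open>u\<close> from the others. Arbitrary finite index sets let the unknowns be columns and the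
  equations rectangles.\<close>

lemma homogeneous_system_nontrivial:
  fixes c :: "'t \<Rightarrow> 'v \<Rightarrow> 'a::field"
  assumes "finite T" "finite V" "card T < card V"
  shows "\<exists>x. (\<exists>v\<in>V. x v \<noteq> 0) \<and> (\<forall>t\<in>T. (\<Sum>v\<in>V. c t v * x v) = 0)"
  using assms
proof (induction T arbitrary: V c rule: finite_induct)
  case empty
  then show ?case by (intro exI[of _ "\<lambda>_. 1"]) (auto simp: card_gt_0_iff)
next
  case (insert t T)
  show ?case
  proof (cases "\<forall>v\<in>V. c t v = 0")
    case True
    then show ?thesis using insert.IH[of V c] insert.prems insert.hyps by auto
  next
    case False
    then obtain u where u: "u \<in> V" "c t u \<noteq> 0" by blast
    define V' where "V' = V - {u}"
    have V: "V = insert u V'" "u \<notin> V'" "finite V'" using u insert.prems V'_def by auto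
    have "card T < card V'" using insert.prems insert.hyps V by simp
    then obtain x where x: "\<exists>v\<in>V'. x v \<noteq> 0"
        "\<forall>s\<in>T. (\<Sum>v\<in>V'. (c s v - c s u * c t v / c t u) * x v) = 0"
      using insert.IH[of V' "\<lambda>s v. c s v - c s u * c t v / c t u"] V by blast
    define S where "S = (\<Sum>v\<in>V'. c t v * x v)"
    \<comment> \<open>The value at \<open>u\<close> is the one that makes equation \<open>t\<close>
      hold.\<close>
    define y where "y = x(u := - S / c t u)"
    have y_eq: "(\<Sum>v\<in>V. c s v * y v) = (\<Sum>v\<in>V'. c s v * x v) - c s u * S / c t u" for s
    proof -
      have "(\<Sum>v\<in>V'. c s v * y v) = (\<Sum>v\<in>V'. c s v * x v)"
        using V(2) by (intro sum.cong) (auto simp: y_def)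
      then show ?thesis using V by (simp add: y_def)
    qed
    have "(\<Sum>v\<in>V. c s v * y v) = 0" if "s \<in> T" for s
    proof -
      have "(\<Sum>v\<in>V'. (c s v - c s u * c t v / c t u) * x v)
          = (\<Sum>v\<in>V'. c s v * x v) - (\<Sum>v\<in>V'. c s u / c t u * (c t v * x v))"
        unfolding sum_subtractf[symmetric] by (intro sum.cong) (auto simp: algebra_simps)
      also have "\<dots> = (\<Sum>v\<in>V. c s v * y v)"
        unfolding y_eq S_def sum_distrib_left[symmetric] by simp
      finally show ?thesis using x(2) that by simp
    qed
    moreover have "(\<Sum>v\<in>V. c t v * y v) = 0" using y_eq[of t] u(2) by (simp add: S_def)
    moreover have "\<exists>v\<in>V. y v \<noteq> 0" using x(1) V by (auto simp: y_def)
    ultimately show ?thesis by (intro exI[of _ y]) simp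
  qed
qed

text \<open>A row at an odd position other than the last of an even block needs the pair formed by
  the last and first positions of its own block. That pair is available only together with those of
  all even blocks, so such a row fills up every even block with pairs starting at odd positions. Any
  other row uses pairs starting at even positions in the even blocks that do not contain it. Each
  even block saves one column set, and the united one costs 1.\<close>

lemma rect_rank_cyc_corel_le:
  assumes ge2: "\<forall>k\<in>set ns. 2 \<le> k"
  shows "rect_rank (cyc_corel ns) \<le> sum_list ns - card {i. i < length ns \<and> even (ns ! i)} + 1"
proof -
  let ?M = "{i. i < length ns \<and> even (ns ! i)}"
  let ?L = "(\<lambda>i. (i, ns ! i - 1)) ` ?M"
  let ?T = "insert None (Some ` (cyc_idx ns - ?L))"
  \<comment> \<open>\<open>None\<close> stands for the united column set, which only the \<open>special\<close> rows use;
    \<open>uses i a k c\<close> says that row \<open>(i, a)\<close> uses the column set \<open>Some (k, c)\<close>.\<close>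
  define special where "special i a \<longleftrightarrow> even (ns ! i) \<and> odd a \<and> Suc a \<noteq> ns ! i" for i a
  define uses where "uses i a k c \<longleftrightarrow>
     (if odd (ns ! k) then k \<noteq> i \<or> c \<noteq> a \<and> c \<noteq> Suc a mod ns ! k
      else if k = i then (if Suc a = ns ! i then odd c else c \<noteq> a \<and> (even c \<longleftrightarrow> even a))
      else if special i a then odd c else even c)" for i a k c
  define I where "I t = (case t of None \<Rightarrow> {v \<in> cyc_idx ns. special (fst v) (snd v)}
     | Some (k, c) \<Rightarrow> {v \<in> cyc_idx ns. uses (fst v) (snd v) k c})" for t
  define J where "J t = (case t of
       None \<Rightarrow> {w \<in> cyc_idx ns. even (ns ! fst w) \<and> (snd w = 0 \<or> Suc (snd w) = ns ! fst w)}
     | Some (k, c) \<Rightarrow> {w \<in> cyc_idx ns. fst w = k \<and> (snd w = c \<or> even (ns ! k) \<and> snd w = Suc c)})" for t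
  have pos: "2 \<le> ns ! i" if "i < length ns" for i using ge2 that by simp
  have adj: "cyc_adj ns (i, a) (k, b) \<longleftrightarrow> k = i \<and> (b = a \<or> (if Suc a = ns ! i then b = 0 else b = Suc a))"
    if "a < ns ! i" for i a k b using that by (auto simp: cyc_adj_def cyc_succ_def)
  have "rect_rank (cyc_corel ns) \<le> card ?T"
  proof (rule rect_rank_le_family[where I = I and J = J])
    fix t assume t: "t \<in> ?T"
    show "I t \<times> J t \<subseteq> cyc_corel ns"
    proof clarify
      fix i a k b assume v: "(i, a) \<in> I t" and w: "(k, b) \<in> J t"
      have V: "(i, a) \<in> cyc_idx ns" "(k, b) \<in> cyc_idx ns"
        using v w by (auto simp: I_def J_def split: option.splits)
      then have a: "a < ns ! i" and b: "b < ns ! k" by (auto simp: cyc_idx_def)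
      have "\<not> cyc_adj ns (i, a) (k, b)"
      proof (cases t)
        case None
        then show ?thesis using v w a b unfolding adj[OF a]
          by (auto simp: I_def J_def special_def; presburger)
      next
        case (Some p)
        then obtain c where c: "t = Some (k, c)" using w by (cases p) (auto simp: J_def)
        then have kc: "c < ns ! k" "even (ns ! k) \<Longrightarrow> Suc c \<noteq> ns ! k" using t by (auto simp: cyc_idx_def)
        show ?thesis using v w a b c kc unfolding adj[OF a]
          by (auto simp: I_def J_def uses_def Suc_mod_if split: if_splits; presburger)
      qed
      then show "((i, a), (k, b)) \<in> cyc_corel ns" using V by (simp add: cyc_corel_def)
    qed
  next
    fix v w assume vw: "(v, w) \<in> cyc_corel ns"
    obtain i a k b where ik: "v = (i, a)" "w = (k, b)" by (cases v; cases w)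
    have V: "(i, a) \<in> cyc_idx ns" "(k, b) \<in> cyc_idx ns"
      and nadj: "\<not> cyc_adj ns (i, a) (k, b)" using vw ik by (auto simp: cyc_corel_def)
    then have a: "a < ns ! i" and b: "b < ns ! k" and k: "k < length ns" by (auto simp: cyc_idx_def)
    have goal_Some: "\<exists>t\<in>?T. v \<in> I t \<and> w \<in> J t"
      if "c < ns ! k" "even (ns ! k) \<Longrightarrow> Suc c \<noteq> ns ! k" "uses i a k c"
         "b = c \<or> even (ns ! k) \<and> b = Suc c" for c
      using that V k ik by (intro bexI[of _ "Some (k, c)"]) (auto simp: I_def J_def cyc_idx_def)
    have goal_None: "\<exists>t\<in>?T. v \<in> I t \<and> w \<in> J t"
      if "special i a" "even (ns ! k)" "b = 0 \<or> Suc b = ns ! k"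
      using that V ik by (intro bexI[of _ None]) (auto simp: I_def J_def)
    show "\<exists>t\<in>?T. v \<in> I t \<and> w \<in> J t"
    proof (cases "odd (ns ! k)")
      case True
      then have "uses i a k b" using nadj a unfolding adj[OF a]
        by (auto simp: uses_def Suc_mod_if)
      then show ?thesis using goal_Some[of b] b True by blast
    next
      case ev: False
      \<comment> \<open>The pairs containing column \<open>b\<close> start at \<open>bE\<close>
        (even) and \<open>bO\<close> (odd). The odd one exists as an index only if \<open>b\<close>
        is neither the first nor the last position; there the column is left to the united
        set.\<close>
      define bE where "bE = (if even b then b else b - 1)"
      define bO where "bO = (if odd b then b else b - 1)"
      have bE: "even bE" "b = bE \<or> b = Suc bE" "bE < ns ! k" "Suc bE \<noteq> ns ! k"
        using ev b unfolding bE_def by (auto elim!: oddE) presburger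
      have bO: "odd bO" "b = bO \<or> b = Suc bO" "bO < ns ! k" "Suc bO \<noteq> ns ! k"
        if "b \<noteq> 0" "Suc b \<noteq> ns ! k"
        using ev b that unfolding bO_def by (auto elim!: oddE evenE)
      have useE: ?thesis if "uses i a k bE" using goal_Some[of bE] bE ev that by blast
      have useO: ?thesis if "b \<noteq> 0" "Suc b \<noteq> ns ! k" "uses i a k bO"
        using goal_Some[of bO] bO[OF that(1,2)] ev that by blast
      consider (other) "k \<noteq> i" "\<not> special i a" | (other_special) "k \<noteq> i" "special i a"
        | (last) "k = i" "Suc a = ns ! i" | (ev) "k = i" "even a" "Suc a \<noteq> ns ! i"
        | (od) "k = i" "odd a" "Suc a \<noteq> ns ! i" by blast
      then show ?thesis
      proof cases
        case other
        then show ?thesis using useE bE ev by (auto simp: uses_def)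
      next
        case other_special
        show ?thesis
        proof (cases "b = 0 \<or> Suc b = ns ! k")
          case True
          then show ?thesis using goal_None other_special ev by blast
        next
          case False
          then show ?thesis using useO bO other_special ev by (auto simp: uses_def)
        qed
      next
        case last
        then have "b \<noteq> 0" "Suc b \<noteq> ns ! k" using nadj unfolding adj[OF a] by auto
        then show ?thesis using useO bO last ev by (auto simp: uses_def)
      next
        case ev': ev
        then have "bE \<noteq> a" using nadj bE unfolding adj[OF a] by auto
        then show ?thesis using useE bE ev ev' by (auto simp: uses_def)
      next
        case od
        show ?thesis
        proof (cases "b = 0 \<or> Suc b = ns ! k")
          case True
          then show ?thesis using goal_None od ev by (auto simp: special_def)
        next
          case False
          then have "bO \<noteq> a" using nadj bO od unfolding adj[OF a] by auto
          then show ?thesis using useO bO False od ev by (auto simp: uses_def)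
        qed
      qed
    qed
  next
    fix v w s t
    assume st: "s \<in> ?T" "t \<in> ?T" and vw: "v \<in> I s" "w \<in> J s" "v \<in> I t" "w \<in> J t"
    obtain i a k b where ik: "v = (i, a)" "w = (k, b)" by (cases v; cases w)
    \<comment> \<open>In even blocks a special row uses only pairs starting at odd positions. Apart
      from the excluded last one, these avoid both ends of the block and so are disjoint from the
      united set.\<close>
    have not_None: False if "Some p \<in> ?T" "v \<in> I (Some p)" "w \<in> J (Some p)" "v \<in> I None" "w \<in> J None" for p
    proof (cases p)
      case (Pair k' c)
      have 1: "k' = k" "b = c \<or> b = Suc c" "even (ns ! k)" "b = 0 \<or> Suc b = ns ! k"
        "special i a" "uses i a k c" "b < ns ! k"
        using that ik Pair by (auto simp: I_def J_def cyc_idx_def)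
      have 2: "Suc c \<noteq> ns ! k" using that Pair 1 by (auto simp: cyc_idx_def)
      have "odd c" using 1 by (auto simp: uses_def special_def split: if_splits)
      then show False using 1 2 by auto presburger
    qed
    show "s = t"
    proof (cases s)
      case None
      then show ?thesis using not_None st vw by (cases t) auto
    next
      case (Some p)
      show ?thesis
      proof (cases t)
        case None
        then show ?thesis using not_None st vw Some by auto
      next
        case (Some q)
        have "fst p = k" "fst q = k"
          using vw(2,4) unfolding \<open>s = Some p\<close> Some ik by (auto simp: J_def split: prod.splits)
        then obtain c d where c: "s = Some (k, c)" "t = Some (k, d)"
          using \<open>s = Some p\<close> Some by (metis prod.collapse)
        have 1: "b = c \<or> even (ns ! k) \<and> b = Suc c" "b = d \<or> even (ns ! k) \<and> b = Suc d"
          "uses i a k c" "uses i a k d"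
          using vw c ik by (auto simp: I_def J_def)
        \<comment> \<open>Within one even block a row uses pairs of one parity only, and two such
          pairs that share a column coincide.\<close>
        have "even c \<longleftrightarrow> even d" if "even (ns ! k)"
          using 1(3,4) that by (auto simp: uses_def split: if_splits)
        then show ?thesis using 1(1,2) c by auto
      qed
    qed
  qed simp
  also have "card ?T = card (cyc_idx ns - ?L) + 1"
    by (simp add: card_image)
  also have "card (cyc_idx ns - ?L) = card (cyc_idx ns) - card ?L"
  proof (rule card_Diff_subset)
    show "?L \<subseteq> cyc_idx ns"
      using pos by (force simp: cyc_idx_def)
  qed simp
  also have "card ?L = card ?M" by (intro card_image) (auto simp: inj_on_def)
  finally show ?thesis by (simp add: card_cyc_idx)
qed

text \<open>Add to the column sums over the rectangles one coordinate functional per even block.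
  A vector killed by all of these alternates along each cycle and hence vanishes.\<close>

lemma rect_rank_cyc_corel_ge:
  assumes ge2: "\<forall>k\<in>set ns. 2 \<le> k" and n2: "sum_list ns \<noteq> 2"
  shows "sum_list ns \<le> rect_rank (cyc_corel ns) + card {i. i < length ns \<and> even (ns ! i)}"
proof (rule ccontr)
  assume less: "\<not> ?thesis"
  let ?M = "{i. i < length ns \<and> even (ns ! i)}" and ?V = "cyc_idx ns"
  obtain P where P: "rect_partition (cyc_corel ns) P" "card P = rect_rank (cyc_corel ns)"
    using rect_rank_attained by blast
  then have part: "partition_on (cyc_corel ns) P" and rect: "\<And>R. R \<in> P \<Longrightarrow> \<exists>I J. R = I \<times> J"
    by (auto simp: rect_partition_def)
  have finP: "finite P" using part by (rule finite_elements[rotated]) simp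
  \<comment> \<open>Equation \<open>Inl R\<close> says that \<open>x\<close> sums to 0 over the
    columns of \<open>R\<close>; equation \<open>Inr i\<close> says that \<open>x\<close> vanishes
    at the first position of block \<open>i\<close>.\<close>
  define c :: "((nat \<times> nat) \<times> nat \<times> nat) set + nat \<Rightarrow> nat \<times> nat \<Rightarrow> real"
    where "c t w = (case t of Inl R \<Rightarrow> of_bool (w \<in> snd ` R) | Inr i \<Rightarrow> of_bool (w = (i, 0)))" for t w
  obtain x where x: "\<exists>v\<in>?V. x v \<noteq> 0" "\<forall>t\<in>P <+> ?M. (\<Sum>w\<in>?V. c t w * x w) = 0"
  proof -
    have "card (P <+> ?M) < card ?V"
      using less P(2) finP by (simp add: card_Plus card_cyc_idx)
    then show ?thesis
      using homogeneous_system_nontrivial[of "P <+> ?M" ?V c] finP that by auto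
  qed
  define S where "S = (\<Sum>w\<in>?V. x w)"
  have snd_sub: "snd ` R \<subseteq> ?V" if "R \<in> P" for R
  proof -
    have "R \<subseteq> cyc_corel ns" using that part by (auto simp: partition_on_def)
    then show ?thesis by (auto simp: cyc_corel_def)
  qed
  have zeroR: "(\<Sum>w\<in>snd ` R. x w) = 0" if "R \<in> P" for R
  proof -
    have "?V \<inter> snd ` R = snd ` R" using snd_sub[OF that] by blast
    moreover have "(\<Sum>w\<in>?V. c (Inl R) w * x w) = 0" using x(2) that by blast
    ultimately show ?thesis by (simp add: c_def of_bool_def if_distrib[of "\<lambda>z. z * _"] sum.If_cases cong: if_cong)
  qed
  have zero0: "x (i, 0) = 0" if "i \<in> ?M" for i
  proof -
    have "(i, 0) \<in> ?V" using that ge2 by (auto simp: cyc_idx_def dest!: nth_mem)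
    moreover have "(\<Sum>w\<in>?V. c (Inr i) w * x w) = 0" using x(2) that by blast
    ultimately show ?thesis by (simp add: c_def of_bool_def if_distrib[of "\<lambda>z. z * _"] cong: if_cong)
  qed
  \<comment> \<open>The column sets of the rectangles that meet row \<open>v\<close> partition the
    ones of that row of the complement. Hence \<open>x\<close> sums to 0 over all columns except
    \<open>v\<close> and its successor.\<close>
  have row: "x v + x (cyc_succ ns v) = S" if v: "v \<in> ?V" for v
  proof -
    define Q where "Q = {R \<in> P. v \<in> fst ` R}"
    have "(\<Sum>w\<in>{w \<in> ?V. \<not> cyc_adj ns v w}. x w) = (\<Sum>R\<in>Q. \<Sum>w\<in>snd ` R. x w)"
    proof -
      have eq: "{w \<in> ?V. \<not> cyc_adj ns v w} = (\<Union>R\<in>Q. snd ` R)" (is "?A = ?B")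
      proof
        show "?A \<subseteq> ?B"
        proof
          fix w assume "w \<in> ?A"
          then have "(v, w) \<in> cyc_corel ns" using v by (simp add: cyc_corel_def)
          then obtain R where "R \<in> P" "(v, w) \<in> R" using part by (auto simp: partition_on_def)
          then show "w \<in> ?B" by (force simp: Q_def)
        qed
        show "?B \<subseteq> ?A"
        proof
          fix w assume "w \<in> ?B"
          then obtain R where R: "R \<in> P" "v \<in> fst ` R" "w \<in> snd ` R" by (auto simp: Q_def)
          then obtain I J where "R = I \<times> J" using rect by blast
          then have "(v, w) \<in> R" using R(2,3) by (auto split: if_splits)
          then have "(v, w) \<in> cyc_corel ns" using R part by (auto simp: partition_on_def)
          then show "w \<in> ?A" by (simp add: cyc_corel_def)
        qed
      qed
      have "(\<Sum>w\<in>(\<Union>R\<in>Q. snd ` R). x w) = (\<Sum>R\<in>Q. \<Sum>w\<in>snd ` R. x w)"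
      proof (rule sum.UNION_disjoint)
        show "finite Q" using finP by (simp add: Q_def)
        show "\<forall>R\<in>Q. finite (snd ` R)"
          using finite_subset[OF snd_sub finite_cyc_idx] by (simp add: Q_def)
        show "\<forall>R\<in>Q. \<forall>R'\<in>Q. R \<noteq> R' \<longrightarrow> snd ` R \<inter> snd ` R' = {}"
        proof (intro ballI impI, rule ccontr)
          fix R R' assume RR: "R \<in> Q" "R' \<in> Q" "R \<noteq> R'" "snd ` R \<inter> snd ` R' \<noteq> {}"
          then obtain w where w: "w \<in> snd ` R" "w \<in> snd ` R'" by blast
          have "(v, w) \<in> R" using rect[of R] RR w by (auto simp: Q_def split: if_splits)
          moreover have "(v, w) \<in> R'" using rect[of R'] RR w by (auto simp: Q_def split: if_splits)
          ultimately show False using part RR unfolding partition_on_def Q_def disjoint_def by blast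
        qed
      qed
      then show ?thesis using eq by simp
    qed
    also have "\<dots> = 0" using zeroR by (simp add: Q_def)
    also have "{w \<in> ?V. \<not> cyc_adj ns v w} = ?V - {v, cyc_succ ns v}"
      by (auto simp: cyc_adj_def)
    finally have "(\<Sum>w\<in>?V - {v, cyc_succ ns v}. x w) = 0" .
    moreover have "v \<noteq> cyc_succ ns v" using cyc_succ_neq[OF ge2 v] by metis
    moreover have "(\<Sum>w\<in>?V - {v, cyc_succ ns v}. x w) = S - (\<Sum>w\<in>{v, cyc_succ ns v}. x w)"
      unfolding S_def using v cyc_succ_in[OF v] by (intro sum_diff) auto
    ultimately show ?thesis by simp
  qed
  \<comment> \<open>Adding the row equations counts every entry of \<open>x\<close> twice, so
    \<open>2 * S = n * S\<close> with \<open>n\<close> the number of columns; this is where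
    \<open>n\<close> must differ from 2.\<close>
  have "S = 0"
  proof -
    have "(\<Sum>v\<in>?V. x v + x (cyc_succ ns v)) = sum_list ns * S"
      using row by (simp add: card_cyc_idx)
    moreover have "(\<Sum>v\<in>?V. x (cyc_succ ns v)) = S"
      unfolding S_def using cyc_succ_bij by (rule sum.reindex_bij_betw)
    ultimately have "(real (sum_list ns) - 2) * S = 0"
      by (simp add: sum.distrib S_def algebra_simps)
    moreover have "real (sum_list ns) \<noteq> 2" using n2 by linarith
    ultimately show ?thesis by simp
  qed
  then have alt: "x (cyc_succ ns v) = - x v" if "v \<in> ?V" for v using row[OF that] by linarith
  have pow: "x (i, a) = (-1) ^ a * x (i, 0)" if "i < length ns" "a < ns ! i" for i a
    using that(2)
  proof (induction a)
    case (Suc a)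
    then show ?case using alt[of "(i, a)"] that(1) by (simp add: cyc_idx_def cyc_succ_def)
  qed simp
  have "x (i, 0) = 0" if i: "i < length ns" for i
  proof (cases "even (ns ! i)")
    \<comment> \<open>Going once round an odd cycle changes the sign an odd number of times, so the
      entry equals its own negative. Here \<open>m\<close> is the last position, whose successor is
      0.\<close>
    case False
    have "ns ! i \<ge> 2" using ge2 i by simp
    then obtain m where m: "ns ! i = Suc m" by (cases "ns ! i") auto
    have "x (i, 0) = - x (i, m)"
      using alt[of "(i, m)"] i m by (simp add: cyc_idx_def cyc_succ_def)
    moreover have "x (i, m) = x (i, 0)" using pow[OF i, of m] m False by simp
    ultimately show ?thesis by simp
  qed (use zero0 i in blast)
  then have "x v = 0" if "v \<in> ?V" for v
    using that pow by (cases v) (auto simp: cyc_idx_def)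
  then show False using x(1) by blast
qed

section \<open>Cycle decomposition of 2-regular relations\<close>

text \<open>If \<open>a\<close> and \<open>b\<close> are fixed-point free involutions, then so is \<open>a \<circ> (b \<circ> a) ^^ k\<close>, being
  conjugate to \<open>a\<close> or \<open>b\<close>.\<close>

lemma dihedral_orbit:
  assumes "\<And>e. a (a e) = e" "\<And>e. b (b e) = e"
    and "\<And>e. e \<in> D \<Longrightarrow> a e \<in> D \<and> a e \<noteq> e" "\<And>e. e \<in> D \<Longrightarrow> b e \<in> D \<and> b e \<noteq> e"
    and "e \<in> D"
  shows "((b \<circ> a) ^^ k) e \<noteq> a e"
  using assms(5)
proof (induction k arbitrary: e rule: induct_nat_012)
  case 0
  then show ?case using assms(3) by (metis eq_id_iff funpow_0)
next
  case 1
  then show ?case using assms(3,4) by simp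
next
  case (ge2 k)
  let ?f = "b \<circ> a"
  show ?case
  proof
    assume "(?f ^^ Suc (Suc k)) e = a e"
    \<comment> \<open>Cancelling the outer \<open>?f\<close> by the involutions leaves the statement
      for \<open>k\<close> at the point \<open>?f e\<close>, which the induction hypothesis
      refutes.\<close>
    then have "?f ((?f ^^ k) (?f e)) = a e" by (metis comp_apply funpow.simps(2) funpow_swap1)
    then have "(?f ^^ k) (?f e) = a (?f e)" using assms(1,2) by (metis comp_apply)
    then show False using ge2 assms(3,4) by simp
  qed
qed

text \<open>Let \<open>a\<close> move a one to the other one in its row, and \<open>b\<close> to the
  other one in its column. Iterating \<open>b\<close> after \<open>a\<close> from a one in row
  \<open>x\<^sub>0\<close> walks along a cycle of the bipartite graph, and \<open>k\<close> is the
  period of this walk. By \<open>dihedral_orbit\<close> the walk never meets a row or column twice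
  within one period.\<close>

lemma two_regular_cycle:
  assumes fin: "finite X" "finite Y" and "x\<^sub>0 \<in> X"
    and row2: "\<And>x. x \<in> X \<Longrightarrow> card {y \<in> Y. E x y} = 2"
    and col2: "\<And>y. y \<in> Y \<Longrightarrow> card {x \<in> X. E x y} = 2"
  obtains k x y where "2 \<le> (k::nat)" "inj_on x {..<k}" "inj_on y {..<k}"
    "x ` {..<k} \<subseteq> X" "y ` {..<k} \<subseteq> Y"
    "\<And>i. i < k \<Longrightarrow> {z \<in> Y. E (x i) z} = {y i, y (Suc i mod k)}"
    "\<And>i. i < k \<Longrightarrow> {z \<in> X. E z (y (Suc i mod k))} = {x i, x (Suc i mod k)}"
proof -
  have "\<exists>w. {z \<in> Y. E x z} = {y, w} \<and> w \<noteq> y" if x: "x \<in> X" and y: "y \<in> Y" and xy: "E x y" for x y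
  proof -
    obtain p q where "{z \<in> Y. E x z} = {p, q}" "p \<noteq> q" using row2[OF x] unfolding card_2_iff by blast
    moreover have "y \<in> {z \<in> Y. E x z}" using y xy by simp
    ultimately show ?thesis by (metis doubleton_eq_iff insertE singletonD)
  qed
  then obtain oc where oc: "\<And>x y. \<lbrakk>x \<in> X; y \<in> Y; E x y\<rbrakk> \<Longrightarrow> {z \<in> Y. E x z} = {y, oc x y} \<and> oc x y \<noteq> y"
    by metis
  have "\<exists>w. {z \<in> X. E z y} = {x, w} \<and> w \<noteq> x" if x: "x \<in> X" and y: "y \<in> Y" and xy: "E x y" for x y
  proof -
    obtain p q where "{z \<in> X. E z y} = {p, q}" "p \<noteq> q" using col2[OF y] unfolding card_2_iff by blast
    moreover have "x \<in> {z \<in> X. E z y}" using x xy by simp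
    ultimately show ?thesis by (metis doubleton_eq_iff insertE singletonD)
  qed
  then obtain orow where orow: "\<And>x y. \<lbrakk>x \<in> X; y \<in> Y; E x y\<rbrakk> \<Longrightarrow> {z \<in> X. E z y} = {x, orow x y} \<and> orow x y \<noteq> x"
    by metis
  define D where "D = {(x, y). x \<in> X \<and> y \<in> Y \<and> E x y}"
  \<comment> \<open>Extended by the identity outside \<open>D\<close>, both maps are permutations of
    the whole type, as required for \<open>least_power\<close>.\<close>
  define a where "a e = (if e \<in> D then (fst e, oc (fst e) (snd e)) else e)" for e
  define b where "b e = (if e \<in> D then (orow (fst e) (snd e), snd e) else e)" for e
  let ?f = "b \<circ> a"
  have finD: "finite D" by (rule finite_subset[of _ "X \<times> Y"]) (auto simp: D_def fin)
  have oc': "oc x y \<in> Y" "E x (oc x y)" "oc x y \<noteq> y" "oc x (oc x y) = y"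
    if "x \<in> X" "y \<in> Y" "E x y" for x y
  proof -
    show 1: "oc x y \<in> Y" "E x (oc x y)" "oc x y \<noteq> y" using oc[OF that] by auto
    show "oc x (oc x y) = y" using oc[OF that] oc[OF that(1) 1(1,2)] by (auto simp: doubleton_eq_iff)
  qed
  have orow': "orow x y \<in> X" "E (orow x y) y" "orow x y \<noteq> x" "orow (orow x y) y = x"
    if "x \<in> X" "y \<in> Y" "E x y" for x y
  proof -
    show 1: "orow x y \<in> X" "E (orow x y) y" "orow x y \<noteq> x" using orow[OF that] by auto
    show "orow (orow x y) y = x" using orow[OF that] orow[OF 1(1) that(2) 1(2)] by (auto simp: doubleton_eq_iff)
  qed
  have aD: "a e \<in> D \<and> a e \<noteq> e" if "e \<in> D" for e
    using that oc' by (auto simp: a_def D_def)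
  have bD: "b e \<in> D \<and> b e \<noteq> e" if "e \<in> D" for e
    using that orow' by (auto simp: b_def D_def)
  have aa: "a (a e) = e" for e using aD[of e] oc' by (auto simp: a_def D_def)
  have bb: "b (b e) = e" for e using bD[of e] orow' by (auto simp: b_def D_def)
  have perm: "p permutes D" if "\<And>e. p (p e) = e" "\<And>e. e \<notin> D \<Longrightarrow> p e = e" for p
    unfolding permutes_def using that by metis
  have "a permutes D" by (rule perm[OF aa]) (simp add: a_def)
  moreover have "b permutes D" by (rule perm[OF bb]) (simp add: b_def)
  ultimately have "permutation ?f" using finD permutation_permutes permutes_compose by blast
  have injf: "inj ?f" using \<open>permutation ?f\<close> by (rule bij_is_inj[OF permutation_bijective])
  obtain y\<^sub>0 where "y\<^sub>0 \<in> {y \<in> Y. E x\<^sub>0 y}" using row2[OF \<open>x\<^sub>0 \<in> X\<close>] unfolding card_2_iff by blast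
  then have e0: "(x\<^sub>0, y\<^sub>0) \<in> D" using \<open>x\<^sub>0 \<in> X\<close> by (simp add: D_def)
  define e where "e i = (?f ^^ i) (x\<^sub>0, y\<^sub>0)" for i
  define k where "k = least_power ?f (x\<^sub>0, y\<^sub>0)"
  have eD: "e i \<in> D" for i by (induction i) (use e0 aD bD in \<open>auto simp: e_def\<close>)
  have e_Suc: "e (Suc i) = b (a (e i))" for i by (simp add: e_def)
  have ek: "e k = e 0"
    using least_power_of_permutation(1)[OF \<open>permutation ?f\<close>] by (simp add: e_def k_def)
  have "k > 0" using least_power_of_permutation(2)[OF \<open>permutation ?f\<close>] by (simp add: k_def)
  have f_neq: "?f (x\<^sub>0, y\<^sub>0) \<noteq> (x\<^sub>0, y\<^sub>0)"
    using e0 oc' orow' by (auto simp: a_def b_def D_def)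
  have k2: "2 \<le> k" using least_power_gt_one[OF \<open>permutation ?f\<close> f_neq] unfolding k_def by linarith
  have e_add: "e (i + j) = (?f ^^ j) (e i)" for i j
    by (simp add: e_def add.commute[of i] funpow_add)
  have e_neq: "e j \<noteq> e i" if "i < j" "j < k" for i j
  proof
    assume "e j = e i"
    then have "(?f ^^ i) ((?f ^^ (j - i)) (x\<^sub>0, y\<^sub>0)) = (?f ^^ i) (x\<^sub>0, y\<^sub>0)"
      using that(1) by (metis e_def comp_apply funpow_add le_add_diff_inverse less_imp_le)
    then have "(?f ^^ (j - i)) (x\<^sub>0, y\<^sub>0) = (x\<^sub>0, y\<^sub>0)"
      using inj_fn[OF injf] by (metis injD)
    then show False using least_power_le[of "j - i" ?f "(x\<^sub>0, y\<^sub>0)"] that by (simp add: k_def)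
  qed
  have e_neq_a: "e j \<noteq> a (e i)" if "i \<le> j" for i j
    using dihedral_orbit[of a b D, OF aa bb aD bD eD, of "j - i" i] e_add[of i "j - i"] that by simp
  have e_neq_b: "e j \<noteq> b (e i)" if ij: "i < j" for i j
  proof
    assume "e j = b (e i)"
    \<comment> \<open>Cancelling \<open>b\<close> goes one step back, to a coincidence of the kind
      excluded by \<open>e_neq_a\<close>.\<close>
    moreover obtain j' where j': "j = Suc j'" using ij by (cases j) auto
    ultimately have "a (e j') = e i" using e_Suc bb by metis
    then show False using e_neq_a[of i j'] aa ij j' by (metis less_Suc_eq_le)
  qed
  define x where "x i = fst (e i)" for i
  define y where "y i = snd (e i)" for i
  have ed: "x i \<in> X" "y i \<in> Y" "E (x i) (y i)" for i
    using eD[of i] by (auto simp: D_def x_def y_def)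
  have ae: "a (e i) = (x i, oc (x i) (y i))" and be: "b (e i) = (orow (x i) (y i), y i)" for i
    using eD[of i] by (auto simp: a_def b_def x_def y_def)
  have ySuc: "y (Suc i) = oc (x i) (y i)" for i
    using aD[OF eD[of i]] ae[of i] e_Suc[of i] by (simp add: y_def b_def)
  have xSuc: "x i = orow (x (Suc i)) (y (Suc i))" for i
  proof -
    have "b (e (Suc i)) = a (e i)" using e_Suc bb by metis
    then show ?thesis using be[of "Suc i"] ae[of i] by (metis fst_conv)
  qed
  have md: "x (Suc i mod k) = x (Suc i)" "y (Suc i mod k) = y (Suc i)" if "i < k" for i
    using ek that by (auto simp: x_def y_def mod_Suc)
  have x_neq: "x j \<noteq> x i" if "i < j" "j < k" for i j
  proof
    assume eq: "x j = x i"
    \<comment> \<open>A row contains only two ones, so entries \<open>i\<close> and \<open>j\<close>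
      of the walk in the same row are equal or interchanged by \<open>a\<close>; both are
      excluded.\<close>
    then have "y j \<in> {z \<in> Y. E (x i) z}" using ed[of j] by simp
    then have "y j = y i \<or> y j = oc (x i) (y i)" using oc[OF ed[of i]] by auto
    then have "e j = e i \<or> e j = a (e i)" using eq ae[of i] by (auto simp: x_def y_def prod_eq_iff)
    then show False using e_neq e_neq_a that by auto
  qed
  have y_neq: "y j \<noteq> y i" if "i < j" "j < k" for i j
  proof
    assume eq: "y j = y i"
    then have "x j \<in> {z \<in> X. E z (y i)}" using ed[of j] by simp
    then have "x j = x i \<or> x j = orow (x i) (y i)" using orow[OF ed[of i]] by auto
    then have "e j = e i \<or> e j = b (e i)" using eq be[of i] by (auto simp: x_def y_def prod_eq_iff)
    then show False using e_neq e_neq_b that by auto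
  qed
  show thesis
  proof (rule that[OF k2, of x y])
    show "inj_on x {..<k}" using x_neq by (metis inj_onI lessThan_iff linorder_neqE_nat)
    show "inj_on y {..<k}" using y_neq by (metis inj_onI lessThan_iff linorder_neqE_nat)
    show "{z \<in> Y. E (x i) z} = {y i, y (Suc i mod k)}" if "i < k" for i
      using oc[OF ed[of i]] ySuc[of i] md[OF that] by simp
    show "{z \<in> X. E z (y (Suc i mod k))} = {x i, x (Suc i mod k)}" if "i < k" for i
      using orow[OF ed[of "Suc i"]] xSuc[of i] md[OF that] by auto
  qed (use ed in auto)
qed

lemma cyc_idx_Cons:
  "cyc_idx (k # ns) = Pair 0 ` {..<k} \<union> map_prod Suc id ` cyc_idx ns"
proof (rule Set.set_eqI)
  fix v show "v \<in> cyc_idx (k # ns) \<longleftrightarrow> v \<in> Pair 0 ` {..<k} \<union> map_prod Suc id ` cyc_idx ns"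
    by (cases v; cases "fst v") (force simp: cyc_idx_def)+
qed

text \<open>Extends a labelling of the blocks of \<open>ns\<close> by a new block 0. It serves the
  inductions for the cycle decomposition and for the block diagonal matrix alike.\<close>

definition cyc_cons :: "(nat \<Rightarrow> 'a) \<Rightarrow> (nat \<times> nat \<Rightarrow> 'a) \<Rightarrow> nat \<times> nat \<Rightarrow> 'a" where
  "cyc_cons x \<sigma> v = (case v of (0, c) \<Rightarrow> x c | (Suc i, c) \<Rightarrow> \<sigma> (i, c))"

lemma cyc_cons_simps [simp]: "cyc_cons x \<sigma> (0, c) = x c" "cyc_cons x \<sigma> (Suc i, c) = \<sigma> (i, c)"
  by (simp_all add: cyc_cons_def)

lemma bij_betw_cyc_cons:
  assumes "bij_betw x {..<k} A" "bij_betw \<sigma> (cyc_idx ns) B" "A \<inter> B = {}"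
  shows "bij_betw (cyc_cons x \<sigma>) (cyc_idx (k # ns)) (A \<union> B)"
  unfolding cyc_idx_Cons
proof (rule bij_betw_combine[OF _ _ assms(3)])
  have "bij_betw (Pair 0) {..<k} (Pair (0::nat) ` {..<k})" by (simp add: bij_betw_def inj_on_def)
  from bij_betw_comp_iff[OF this, of "cyc_cons x \<sigma>" A]
  show "bij_betw (cyc_cons x \<sigma>) (Pair 0 ` {..<k}) A" using assms(1) by (simp add: o_def)
  have "bij_betw (map_prod Suc id) (cyc_idx ns) (map_prod Suc id ` cyc_idx ns)"
    by (auto simp: bij_betw_def inj_on_def)
  from bij_betw_comp_iff[OF this, of "cyc_cons x \<sigma>" B]
  show "bij_betw (cyc_cons x \<sigma>) (map_prod Suc id ` cyc_idx ns) B"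
    using assms(2) by (simp add: o_def case_prod_beta' map_prod_def)
qed

lemma cyc_adj_Cons [simp]:
  "cyc_adj (k # ns) (0, c) (0, d) \<longleftrightarrow> d = c \<or> d = Suc c mod k"
  "cyc_adj (k # ns) (0, c) (Suc j, d) \<longleftrightarrow> False"
  "cyc_adj (k # ns) (Suc i, c) (0, d) \<longleftrightarrow> False"
  "cyc_adj (k # ns) (Suc i, c) (Suc j, d) \<longleftrightarrow> cyc_adj ns (i, c) (j, d)"
  by (auto simp: cyc_adj_def cyc_succ_def)

text \<open>Split off one cycle and recurse. Rows and columns of the cycle have all their ones
  inside it, so what remains is again 2-regular.\<close>

lemma two_regular_cycle_decomposition:
  assumes "finite X" "finite Y"
    and "\<And>x. x \<in> X \<Longrightarrow> card {y \<in> Y. E x y} = 2"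
    and "\<And>y. y \<in> Y \<Longrightarrow> card {x \<in> X. E x y} = 2"
  shows "\<exists>ns \<sigma> \<tau>. (\<forall>k\<in>set ns. 2 \<le> k) \<and> bij_betw \<sigma> (cyc_idx ns) X \<and> bij_betw \<tau> (cyc_idx ns) Y \<and>
    (\<forall>v\<in>cyc_idx ns. \<forall>w\<in>cyc_idx ns. E (\<sigma> v) (\<tau> w) \<longleftrightarrow> cyc_adj ns v w)"
  using assms
proof (induction "card X" arbitrary: X Y rule: less_induct)
  case less
  show ?case
  proof (cases "X = {}")
    case True
    then have "Y = {}" using less.prems(4) by fastforce
    then show ?thesis using True by (intro exI[of _ "[]"]) (simp add: cyc_idx_def bij_betw_def)
  next
    case False
    then obtain x\<^sub>0 where "x\<^sub>0 \<in> X" by blast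
    obtain k x y where k: "2 \<le> (k::nat)" and inj: "inj_on x {..<k}" "inj_on y {..<k}"
      and sub: "x ` {..<k} \<subseteq> X" "y ` {..<k} \<subseteq> Y"
      and row: "\<And>i. i < k \<Longrightarrow> {z \<in> Y. E (x i) z} = {y i, y (Suc i mod k)}"
      and col: "\<And>i. i < k \<Longrightarrow> {z \<in> X. E z (y (Suc i mod k))} = {x i, x (Suc i mod k)}"
      using two_regular_cycle[OF less.prems(1,2) \<open>x\<^sub>0 \<in> X\<close> less.prems(3,4)] by blast
    \<comment> \<open>The description of the columns is indexed by successors modulo
      \<open>k\<close>, so each \<open>i\<close> is written as the successor of its cyclic
      predecessor.\<close>
    have col': "{z \<in> X. E z (y i)} \<subseteq> x ` {..<k}" if "i < k" for i
    proof -
      have "\<exists>j<k. i = Suc j mod k"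
        using that k by (intro exI[of _ "if i = 0 then k - 1 else i - 1"]) auto
      then obtain j where "j < k" "i = Suc j mod k" by blast
      then show ?thesis using col[of j] k by auto
    qed
    have row': "{z \<in> Y. E (x i) z} \<subseteq> y ` {..<k}" if "i < k" for i
      using row[OF that] that k by auto
    define X' where "X' = X - x ` {..<k}"
    define Y' where "Y' = Y - y ` {..<k}"
    have no1: "\<not> E u (y i)" if "u \<in> X'" "i < k" for u i
      using col'[OF that(2)] that(1) by (auto simp: X'_def)
    have no2: "\<not> E (x i) u" if "u \<in> Y'" "i < k" for u i
      using row'[OF that(2)] that(1) by (auto simp: Y'_def)
    have "x 0 \<in> X" "x 0 \<notin> X'" using sub k by (auto simp: X'_def)
    then have "X' \<subset> X" by (auto simp: X'_def)
    then have lt: "card X' < card X" using less.prems(1) by (intro psubset_card_mono)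
    have row2': "card {v \<in> Y'. E u v} = 2" if "u \<in> X'" for u
    proof -
      have "{v \<in> Y'. E u v} = {v \<in> Y. E u v}" using no1[OF that] by (auto simp: Y'_def)
      then show ?thesis using less.prems(3) that by (simp add: X'_def)
    qed
    have col2': "card {u \<in> X'. E u v} = 2" if "v \<in> Y'" for v
    proof -
      have "{u \<in> X'. E u v} = {u \<in> X. E u v}" using no2[OF that] by (auto simp: X'_def)
      then show ?thesis using less.prems(4) that by (simp add: Y'_def)
    qed
    have fin': "finite X'" "finite Y'" using less.prems by (auto simp: X'_def Y'_def)
    obtain ns \<sigma> \<tau> where ns: "\<forall>k\<in>set ns. 2 \<le> k"
      and \<sigma>: "bij_betw \<sigma> (cyc_idx ns) X'" and \<tau>: "bij_betw \<tau> (cyc_idx ns) Y'"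
      and E: "\<forall>v\<in>cyc_idx ns. \<forall>w\<in>cyc_idx ns. E (\<sigma> v) (\<tau> w) \<longleftrightarrow> cyc_adj ns v w"
      using less.hyps[OF lt fin' row2' col2'] by blast
    have X: "x ` {..<k} \<union> X' = X" and Y: "y ` {..<k} \<union> Y' = Y" using sub by (auto simp: X'_def Y'_def)
    have "bij_betw (cyc_cons x \<sigma>) (cyc_idx (k # ns)) (x ` {..<k} \<union> X')"
      using inj \<sigma> by (intro bij_betw_cyc_cons inj_on_imp_bij_betw) (auto simp: X'_def)
    moreover have "bij_betw (cyc_cons y \<tau>) (cyc_idx (k # ns)) (y ` {..<k} \<union> Y')"
      using inj \<tau> by (intro bij_betw_cyc_cons inj_on_imp_bij_betw) (auto simp: Y'_def)
    moreover have "E (cyc_cons x \<sigma> v) (cyc_cons y \<tau> w) \<longleftrightarrow> cyc_adj (k # ns) v w"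
      if v: "v \<in> cyc_idx (k # ns)" and w: "w \<in> cyc_idx (k # ns)" for v w
    proof -
      have \<sigma>X: "\<sigma> u \<in> X'" if "u \<in> cyc_idx ns" for u using \<sigma> that by (auto simp: bij_betw_def)
      have \<tau>Y: "\<tau> u \<in> Y'" if "u \<in> cyc_idx ns" for u using \<tau> that by (auto simp: bij_betw_def)
      have cyc: "E (x c) (y d) \<longleftrightarrow> d = c \<or> d = Suc c mod k" if "c < k" "d < k" for c d
      proof -
        have "E (x c) (y d) \<longleftrightarrow> y d \<in> {z \<in> Y. E (x c) z}" using sub that by auto
        also have "\<dots> \<longleftrightarrow> y d = y c \<or> y d = y (Suc c mod k)" using row[OF that(1)] by simp
        also have "\<dots> \<longleftrightarrow> d = c \<or> d = Suc c mod k"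
          using inj_on_eq_iff[OF inj(2)] that k by auto
        finally show ?thesis .
      qed
      from v w show ?thesis unfolding cyc_idx_Cons
        using cyc no1 no2 \<sigma>X \<tau>Y E by auto
    qed
    ultimately show ?thesis unfolding X Y using ns k
      by (intro exI[of _ "k # ns"] exI[of _ "cyc_cons x \<sigma>"] exI[of _ "cyc_cons y \<tau>"]) auto
  qed
qed

section \<open>Circulant block diagonal matrices\<close>

lemma circ_mat_two_index:
  assumes "2 \<le> k" "i < k" "j < k"
  shows "circ_mat k (k - 2) $$ (i, j) = of_bool (j = i \<or> j = Suc i mod k)"
proof -
  have "(k + j - i) mod k = (if i \<le> j then j - i else k + j - i)"
  proof (cases "i \<le> j")
    case True
    then have "k + j - i = (j - i) + k" by simp
    then show ?thesis unfolding \<open>k + j - i = (j - i) + k\<close> mod_add_self2 using True assms by simp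
  qed (use assms in auto)
  then show ?thesis using assms by (auto simp: circ_mat_def Suc_mod_if)
qed

lemma dim_circ_block_diag2 [simp]:
  "dim_row (circ_block_diag2 ns) = sum_list ns" "dim_col (circ_block_diag2 ns) = sum_list ns"
  by (simp_all add: circ_block_diag2_def dim_diag_block_mat o_def circ_mat_def)

lemma circ_block_diag2_Cons:
  "circ_block_diag2 (k # ns) = four_block_mat (circ_mat k (k - 2)) (0\<^sub>m k (sum_list ns))
     (0\<^sub>m (sum_list ns) k) (circ_block_diag2 ns)"
  using dim_circ_block_diag2[of ns]
  by (simp add: circ_block_diag2_def Let_def circ_mat_def)

text \<open>The bijection sends \<open>(i, a)\<close> to \<open>a\<close> plus the total size of the
  earlier blocks. The induction adds \<open>k\<close> at each step, so these offsets never have to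
  be written out.\<close>

lemma circ_block_diag2_index:
  assumes "\<forall>k\<in>set ns. 2 \<le> k"
  shows "\<exists>\<psi>. bij_betw \<psi> (cyc_idx ns) {..<sum_list ns} \<and>
    (\<forall>v\<in>cyc_idx ns. \<forall>w\<in>cyc_idx ns. circ_block_diag2 ns $$ (\<psi> v, \<psi> w) = of_bool (cyc_adj ns v w))"
  using assms
proof (induction ns)
  case Nil
  then show ?case by (simp add: cyc_idx_def bij_betw_def)
next
  case (Cons k ns)
  then obtain \<psi> where \<psi>: "bij_betw \<psi> (cyc_idx ns) {..<sum_list ns}"
    "\<And>v w. \<lbrakk>v \<in> cyc_idx ns; w \<in> cyc_idx ns\<rbrakk> \<Longrightarrow> circ_block_diag2 ns $$ (\<psi> v, \<psi> w) = of_bool (cyc_adj ns v w)"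
    by auto
  have lt: "\<psi> v < sum_list ns" if "v \<in> cyc_idx ns" for v using \<psi>(1) that by (auto simp: bij_betw_def)
  let ?\<psi> = "cyc_cons (\<lambda>c. c) (\<lambda>v. k + \<psi> v)"
  have "bij_betw (\<lambda>v. k + \<psi> v) (cyc_idx ns) {k..<k + sum_list ns}"
  proof -
    have "bij_betw ((+) k) {..<sum_list ns} {k..<k + sum_list ns}"
      by (simp add: bij_betw_def lessThan_atLeast0 add.commute)
    from bij_betw_trans[OF \<psi>(1) this] show ?thesis by (simp add: o_def)
  qed
  then have "bij_betw ?\<psi> (cyc_idx (k # ns)) ({..<k} \<union> {k..<k + sum_list ns})"
    by (intro bij_betw_cyc_cons) (auto simp: bij_betw_def)
  moreover have "{..<k} \<union> {k..<k + sum_list ns} = {..<sum_list (k # ns)}" by auto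
  moreover have "circ_block_diag2 (k # ns) $$ (?\<psi> v, ?\<psi> w) = of_bool (cyc_adj (k # ns) v w)"
    if v: "v \<in> cyc_idx (k # ns)" and w: "w \<in> cyc_idx (k # ns)" for v w
  proof -
    have dim: "dim_row (circ_mat k (k - 2)) = k" "dim_col (circ_mat k (k - 2)) = k"
      by (simp_all add: circ_mat_def)
    have "2 \<le> k" using Cons.prems by simp
    from v w show ?thesis unfolding cyc_idx_Cons circ_block_diag2_Cons
      using \<psi>(2) lt circ_mat_two_index[OF \<open>2 \<le> k\<close>] by (auto simp: dim trans_less_add1)
  qed
  ultimately show ?case by (intro exI[of _ ?\<psi>]) simp
qed

text \<open>Together with \<open>perm_equiv_circ_block_diag2I\<close> this replaces permutation
  equivalence by separate labellings of rows and columns.\<close>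

lemma perm_equiv_circ_block_diag2_cycles:
  assumes ge2: "\<forall>k\<in>set ns. 2 \<le> k" and "perm_equiv_mat M (circ_block_diag2 ns)"
  obtains \<sigma> \<tau> where "bij_betw \<sigma> (cyc_idx ns) {..<sum_list ns}" "bij_betw \<tau> (cyc_idx ns) {..<sum_list ns}"
    "\<And>v w. \<lbrakk>v \<in> cyc_idx ns; w \<in> cyc_idx ns\<rbrakk> \<Longrightarrow> M $$ (\<sigma> v, \<tau> w) = of_bool (cyc_adj ns v w)"
proof -
  let ?N = "sum_list ns"
  obtain p q where p: "p permutes {..<?N}" and q: "q permutes {..<?N}"
    and M: "M = mat ?N ?N (\<lambda>(i, j). circ_block_diag2 ns $$ (p i, q j))"
    using assms(2) unfolding perm_equiv_mat_def dim_circ_block_diag2 by blast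
  obtain \<psi> where \<psi>: "bij_betw \<psi> (cyc_idx ns) {..<?N}"
    and B: "\<forall>v\<in>cyc_idx ns. \<forall>w\<in>cyc_idx ns. circ_block_diag2 ns $$ (\<psi> v, \<psi> w) = of_bool (cyc_adj ns v w)"
    using circ_block_diag2_index[OF ge2] by blast
  show thesis
  proof (rule that)
    show \<sigma>: "bij_betw (inv_into UNIV p \<circ> \<psi>) (cyc_idx ns) {..<?N}"
      using bij_betw_trans[OF \<psi> permutes_imp_bij[OF permutes_inv[OF p]]] .
    show \<tau>: "bij_betw (inv_into UNIV q \<circ> \<psi>) (cyc_idx ns) {..<?N}"
      using bij_betw_trans[OF \<psi> permutes_imp_bij[OF permutes_inv[OF q]]] .
    fix v w assume vw: "v \<in> cyc_idx ns" "w \<in> cyc_idx ns"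
    have "(inv_into UNIV p \<circ> \<psi>) v < ?N" "(inv_into UNIV q \<circ> \<psi>) w < ?N"
      using bij_betwE[OF \<sigma>] bij_betwE[OF \<tau>] vw by auto
    then show "M $$ ((inv_into UNIV p \<circ> \<psi>) v, (inv_into UNIV q \<circ> \<psi>) w) = of_bool (cyc_adj ns v w)"
      using B vw by (simp add: M permutes_inverses[OF p] permutes_inverses[OF q])
  qed
qed

lemma perm_equiv_circ_block_diag2I:
  assumes ge2: "\<forall>k\<in>set ns. 2 \<le> k" and M: "M \<in> carrier_mat n n"
    and \<sigma>: "bij_betw \<sigma> (cyc_idx ns) {..<n}" and \<tau>: "bij_betw \<tau> (cyc_idx ns) {..<n}"
    and E: "\<And>v w. \<lbrakk>v \<in> cyc_idx ns; w \<in> cyc_idx ns\<rbrakk> \<Longrightarrow> M $$ (\<sigma> v, \<tau> w) = of_bool (cyc_adj ns v w)"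
  shows "perm_equiv_mat M (circ_block_diag2 ns)"
proof -
  let ?V = "cyc_idx ns"
  have n: "sum_list ns = n" using bij_betw_same_card[OF \<sigma>] by (simp add: card_cyc_idx)
  obtain \<psi> where \<psi>: "bij_betw \<psi> ?V {..<n}"
    and B: "\<forall>v\<in>?V. \<forall>w\<in>?V. circ_block_diag2 ns $$ (\<psi> v, \<psi> w) = of_bool (cyc_adj ns v w)"
    using circ_block_diag2_index[OF ge2] n by blast
  \<comment> \<open>Row or column \<open>i\<close> goes through its label to its place in the block
    matrix. Outside the index range the map is the identity, as \<open>permutes\<close>
    demands.\<close>
  define ext where "ext \<rho> i = (if i < n then \<psi> (inv_into ?V \<rho> i) else i)" for \<rho> i
  have perm: "ext \<rho> permutes {..<n}" if "bij_betw \<rho> ?V {..<n}" for \<rho>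
  proof (rule bij_imp_permutes)
    have "bij_betw (\<psi> \<circ> inv_into ?V \<rho>) {..<n} {..<n}"
      by (rule bij_betw_trans[OF bij_betw_inv_into[OF that] \<psi>])
    then show "bij_betw (ext \<rho>) {..<n} {..<n}"
      by (rule bij_betw_cong[THEN iffD1, rotated]) (simp add: ext_def)
  qed (simp add: ext_def)
  have "M = mat n n (\<lambda>(i, j). circ_block_diag2 ns $$ (ext \<sigma> i, ext \<tau> j))"
  proof (rule eq_matI)
    fix i j assume "i < dim_row (mat n n (\<lambda>(i, j). circ_block_diag2 ns $$ (ext \<sigma> i, ext \<tau> j)))"
      and "j < dim_col (mat n n (\<lambda>(i, j). circ_block_diag2 ns $$ (ext \<sigma> i, ext \<tau> j)))"
    then have ij: "i < n" "j < n" by auto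
    define v where "v = inv_into ?V \<sigma> i"
    define w where "w = inv_into ?V \<tau> j"
    have v: "v \<in> ?V" "\<sigma> v = i" and w: "w \<in> ?V" "\<tau> w = j"
      using ij \<sigma> \<tau> unfolding v_def w_def bij_betw_def
      by (auto intro!: inv_into_into f_inv_into_f)
    have "M $$ (i, j) = circ_block_diag2 ns $$ (\<psi> v, \<psi> w)" using E[OF v(1) w(1)] B v w by simp
    then show "M $$ (i, j) = mat n n (\<lambda>(i, j). circ_block_diag2 ns $$ (ext \<sigma> i, ext \<tau> j)) $$ (i, j)"
      using ij by (simp add: ext_def v_def w_def)
  qed (use M in auto)
  then show ?thesis unfolding perm_equiv_mat_def dim_circ_block_diag2 n
    using perm[OF \<sigma>] perm[OF \<tau>] M by blast
qed

text \<open>The predicate \<open>Q\<close> is left open so that one pair of labellings serves both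
  the matrix, with \<open>cyc_adj\<close>, and its complement, with the negation.\<close>

lemma binary_rank_eq_rect_rank_bij:
  assumes A: "A \<in> carrier_mat n n" and V: "finite V"
    and \<sigma>: "bij_betw \<sigma> V {..<n}" and \<tau>: "bij_betw \<tau> V {..<n}"
    and Q: "\<And>v w. \<lbrakk>v \<in> V; w \<in> V\<rbrakk> \<Longrightarrow> A $$ (\<sigma> v, \<tau> w) = 1 \<longleftrightarrow> Q v w"
  shows "binary_rank A = rect_rank {(v, w) \<in> V \<times> V. Q v w}"
proof -
  let ?E = "{(v, w) \<in> V \<times> V. Q v w}"
  have "ones_of A = map_prod \<sigma> \<tau> ` ?E"
  proof
    show "ones_of A \<subseteq> map_prod \<sigma> \<tau> ` ?E"
    proof clarify
      fix i j assume ij: "(i, j) \<in> ones_of A"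
      then have "i \<in> \<sigma> ` V" "j \<in> \<tau> ` V" using A \<sigma> \<tau> by (auto simp: ones_of_def bij_betw_def)
      then obtain v w where "v \<in> V" "w \<in> V" "i = \<sigma> v" "j = \<tau> w" by blast
      then show "(i, j) \<in> map_prod \<sigma> \<tau> ` ?E" using ij Q by (force simp: ones_of_def)
    qed
    show "map_prod \<sigma> \<tau> ` ?E \<subseteq> ones_of A"
      using A Q bij_betwE[OF \<sigma>] bij_betwE[OF \<tau>] by (auto simp: ones_of_def)
  qed
  moreover have "?E \<subseteq> V \<times> V" by blast
  moreover from this have "finite ?E" using V by (meson finite_SigmaI finite_subset)
  ultimately show ?thesis
    using rect_rank_image[of \<sigma> V \<tau> V ?E] \<sigma> \<tau> by (simp add: binary_rank_eq_rect_rank bij_betw_def)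
qed

lemma regular_two_mat_cycles:
  assumes M: "M \<in> carrier_mat n n" and reg: "regular_mat 2 M"
  shows "\<exists>ns. (\<forall>k\<in>set ns. 2 \<le> k) \<and> perm_equiv_mat M (circ_block_diag2 ns)"
proof -
  have "card {y \<in> {..<n}. M $$ (x, y) = 1} = 2" if "x \<in> {..<n}" for x
    using that M reg by (simp add: regular_mat_def)
  moreover have "card {x \<in> {..<n}. M $$ (x, y) = 1} = 2" if "y \<in> {..<n}" for y
    using that M reg by (simp add: regular_mat_def)
  ultimately obtain ns \<sigma> \<tau> where ns: "\<forall>k\<in>set ns. 2 \<le> k"
    and \<sigma>: "bij_betw \<sigma> (cyc_idx ns) {..<n}" and \<tau>: "bij_betw \<tau> (cyc_idx ns) {..<n}"
    and E: "\<forall>v\<in>cyc_idx ns. \<forall>w\<in>cyc_idx ns. M $$ (\<sigma> v, \<tau> w) = 1 \<longleftrightarrow> cyc_adj ns v w"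
    using two_regular_cycle_decomposition[of "{..<n}" "{..<n}" "\<lambda>x y. M $$ (x, y) = 1"] by auto
  have "M $$ (\<sigma> v, \<tau> w) = of_bool (cyc_adj ns v w)" if "v \<in> cyc_idx ns" "w \<in> cyc_idx ns" for v w
  proof -
    have "\<sigma> v < n" "\<tau> w < n" using bij_betwE[OF \<sigma>] bij_betwE[OF \<tau>] that by auto
    then have "M $$ (\<sigma> v, \<tau> w) = 0 \<or> M $$ (\<sigma> v, \<tau> w) = 1"
      using M reg by (simp add: regular_mat_def zero_one_mat_def)
    then show ?thesis using E that by force
  qed
  from perm_equiv_circ_block_diag2I[OF ns M \<sigma> \<tau> this] ns show ?thesis by blast
qed

text \<open>Turns the exclusion of the all-one matrix into the condition that the dimension is not
  2, on which \<open>rect_rank_cyc_corel_ge\<close> depends.\<close>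

lemma regular_two_mat_dim_two:
  assumes M: "M \<in> carrier_mat 2 2" and reg: "regular_mat 2 M"
  shows "M = mat 2 2 (\<lambda>_. 1)"
proof (rule eq_matI)
  fix i j assume "i < dim_row (mat 2 2 (\<lambda>_. 1 :: real))" "j < dim_col (mat 2 2 (\<lambda>_. 1 :: real))"
  then have ij: "i < 2" "j < 2" by auto
  have "card {j. j < 2 \<and> M $$ (i, j) = 1} = card {..<2::nat}"
    using M reg ij by (simp add: regular_mat_def)
  then have "{j. j < 2 \<and> M $$ (i, j) = 1} = {..<2}" by (intro card_subset_eq) auto
  then show "M $$ (i, j) = mat 2 2 (\<lambda>_. 1) $$ (i, j)" using ij by auto
qed (use M in auto)

theorem theorem1p6:
  fixes M :: "real mat" and n :: nat
  assumes "n > 0" and "M \<in> carrier_mat n n" and "regular_mat 2 M"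
  shows "(\<exists>ns. length ns \<ge> 1 \<and> (\<forall>k \<in> set ns. k \<ge> 2) \<and>
            perm_equiv_mat M (circ_block_diag2 ns)) \<and>
         (\<forall>ns m\<^sub>2 m_even.
            length ns \<ge> 1 \<and> (\<forall>k \<in> set ns. k \<ge> 2) \<and>
            perm_equiv_mat M (circ_block_diag2 ns) \<and>
            m\<^sub>2 = card {i. i < length ns \<and> ns ! i = 2} \<and>
            m_even = card {i. i < length ns \<and> even (ns ! i)} \<and>
            M \<noteq> mat 2 2 (\<lambda>_. 1) \<longrightarrow>
              int (binary_rank M) = int n - int m\<^sub>2 \<and>
              int (binary_rank (compl_mat M)) \<in>
                {int n - int m_even, int n - int m_even + 1})"
proof (rule conjI)
  obtain ns where ns: "\<forall>k\<in>set ns. 2 \<le> k" "perm_equiv_mat M (circ_block_diag2 ns)"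
    using regular_two_mat_cycles[OF assms(2,3)] by blast
  then have "sum_list ns = n" using assms(2) by (auto simp: perm_equiv_mat_def)
  then have "length ns \<ge> 1" using \<open>n > 0\<close> by (cases ns) auto
  then show "\<exists>ns. length ns \<ge> 1 \<and> (\<forall>k \<in> set ns. k \<ge> 2) \<and> perm_equiv_mat M (circ_block_diag2 ns)"
    using ns by blast
next
  have "int (binary_rank M) = int n - int (card {i. i < length ns \<and> ns ! i = 2}) \<and>
      int (binary_rank (compl_mat M)) \<in> {int n - int (card {i. i < length ns \<and> even (ns ! i)}),
        int n - int (card {i. i < length ns \<and> even (ns ! i)}) + 1}"
    if ge2: "\<forall>k\<in>set ns. 2 \<le> k" and pe: "perm_equiv_mat M (circ_block_diag2 ns)"
      and not2: "M \<noteq> mat 2 2 (\<lambda>_. 1)" for ns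
  proof -
    obtain \<sigma> \<tau> where \<sigma>: "bij_betw \<sigma> (cyc_idx ns) {..<sum_list ns}"
      and \<tau>: "bij_betw \<tau> (cyc_idx ns) {..<sum_list ns}"
      and E: "\<And>v w. \<lbrakk>v \<in> cyc_idx ns; w \<in> cyc_idx ns\<rbrakk> \<Longrightarrow> M $$ (\<sigma> v, \<tau> w) = of_bool (cyc_adj ns v w)"
      using perm_equiv_circ_block_diag2_cycles[OF ge2 pe] by blast
    have n: "sum_list ns = n" using pe assms(2) by (auto simp: perm_equiv_mat_def)
    note \<sigma> = \<sigma>[unfolded n] and \<tau> = \<tau>[unfolded n]
    have "binary_rank M = rect_rank (cyc_rel ns)"
      unfolding cyc_rel_def using E
      by (intro binary_rank_eq_rect_rank_bij[OF assms(2) finite_cyc_idx \<sigma> \<tau>]) simp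
    moreover have "binary_rank (compl_mat M) = rect_rank (cyc_corel ns)"
      unfolding cyc_corel_def
    proof (rule binary_rank_eq_rect_rank_bij[OF _ finite_cyc_idx \<sigma> \<tau>])
      show "compl_mat M \<in> carrier_mat n n" using assms(2) by (simp add: compl_mat_def)
      fix v w assume vw: "v \<in> cyc_idx ns" "w \<in> cyc_idx ns"
      then have "\<sigma> v < n" "\<tau> w < n" using bij_betwE[OF \<sigma>] bij_betwE[OF \<tau>] by auto
      then show "compl_mat M $$ (\<sigma> v, \<tau> w) = 1 \<longleftrightarrow> \<not> cyc_adj ns v w"
        using assms(2) E[OF vw] by (simp add: compl_mat_def)
    qed
    moreover have "sum_list ns \<noteq> 2" using not2 regular_two_mat_dim_two[of M] assms(2,3) n by auto
    \<comment> \<open>The bounds on the ranks use truncated subtraction of naturals; with this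
      inequality they carry over to the integers.\<close>
    moreover have "card {i. i < length ns \<and> P (ns ! i)} \<le> sum_list ns" for P
    proof -
      have "card {i. i < length ns \<and> P (ns ! i)} \<le> card {..<length ns}" by (intro card_mono) auto
      also have "\<dots> = (\<Sum>i<length ns. 1)" by simp
      also have "\<dots> \<le> (\<Sum>i<length ns. ns ! i)"
      proof (rule sum_mono)
        fix i assume "i \<in> {..<length ns}"
        then have "2 \<le> ns ! i" using ge2 by simp
        then show "1 \<le> ns ! i" by simp
      qed
      also have "\<dots> = sum_list ns" by (simp add: sum_list_sum_nth atLeast0LessThan)
      finally show ?thesis .
    qed
    note this[of "\<lambda>k. k = 2"] this[of even]
    ultimately show ?thesis
      using rect_rank_cyc_rel_le[OF ge2] rect_rank_cyc_rel_ge[OF ge2]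
        rect_rank_cyc_corel_le[OF ge2] rect_rank_cyc_corel_ge[OF ge2] n by auto
  qed
  then show "\<forall>ns m\<^sub>2 m_even.
            length ns \<ge> 1 \<and> (\<forall>k \<in> set ns. k \<ge> 2) \<and>
            perm_equiv_mat M (circ_block_diag2 ns) \<and>
            m\<^sub>2 = card {i. i < length ns \<and> ns ! i = 2} \<and>
            m_even = card {i. i < length ns \<and> even (ns ! i)} \<and>
            M \<noteq> mat 2 2 (\<lambda>_. 1) \<longrightarrow>
              int (binary_rank M) = int n - int m\<^sub>2 \<and>
              int (binary_rank (compl_mat M)) \<in>
                {int n - int m_even, int n - int m_even + 1}"
    by blast
qed

end
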